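(* Suppose that the penalty function $\zeta:[0,1]\to[-\infty,+\infty]$ commutes with the operator $\mathbb E_{\boldsymbol{s}_{k+1}}$ for all $k=0,1,\ldots,N-1$, i.e. $$\zeta\big(V^{\boldsymbol{\pi}^{k}}_{k}(\boldsymbol{s}_{k})\big)=\zeta\Big(\mathbb E_{\boldsymbol{s}_{k+1}}\big[V^{\boldsymbol{\pi}^{k+1}}_{k+1}(\boldsymbol{s}_{k+1})\,\big|\,\boldsymbol{s}_k,\boldsymbol{\pi}_k(\boldsymbol{s}_k)\big]\Big)=\mathbb E_{\boldsymbol{s}_{k+1}}\Big[\zeta\big(V^{\boldsymbol{\pi}^{k+1}}_{k+1}(\boldsymbol{s}_{k+1})\big)\,\Big|\,\boldsymbol{s}_k,\boldsymbol{\pi}_k(\boldsymbol{s}_k)\Big].$$ Then the problem $$\tilde J^*(\boldsymbol{s}_0)=\min_{\boldsymbol{\pi}}\ \mathbb E\Big[\sum_{k=0}^{N-1}\ell(\boldsymbol{s}_k,\boldsymbol{a}_k)+\ell_N(\boldsymbol{s}_N)\,\Big|\,\boldsymbol{s}_0,\boldsymbol{\pi}\Big]+\zeta\big(V_0^{\boldsymbol{\pi}}(\boldsymbol{s}_0)\big)\qquad(\ast)$$ can be solved via the following dynamic programming recursion on the state space: $$\tilde J_N(\boldsymbol{s}_N)=\ell_N(\boldsymbol{s}_N)+\zeta\big(V_N(\boldsymbol{s}_N)\big),$$ $$\tilde J_k(\boldsymbol{s}_k)=\min_{\boldsymbol{a}_k\in\mathcal A}\ \ell(\boldsymbol{s}_k,\boldsymbol{a}_k)+\int_{\mathbb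 S}\tilde J_{k+1}(\boldsymbol{s}_{k+1})\,\rho[\boldsymbol{s}_{k+1}\,|\,\boldsymbol{s}_k,\boldsymbol{a}_k]\,\mathrm d\boldsymbol{s}_{k+1},\qquad k=N-1,N-2,\ldots,0.\qquad(\ast\ast)$$ That is, for every initial state $\boldsymbol{s}_0$, the optimal cost $\tilde J^*(\boldsymbol{s}_0)$ of problem $(\ast)$ is equal to $\tilde J_0(\boldsymbol{s}_0)$, given by the last step (backward in time) of the recursion. Furthermore, if $\boldsymbol{\pi}_k^*(\boldsymbol{s}_k)=\boldsymbol{a}_k^*$ minimizes the right-hand side of $(\ast\ast)$ for each $\boldsymbol{s}_k$ and $k$, then the policy $\boldsymbol{\pi}^*=\{\boldsymbol{\pi}^*_0,\ldots,\boldsymbol{\pi}^*_{N-1}\}$ is optimal for problem $(\ast)$.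
   Context: Setting: a discrete-time Markov Decision Process with state space $\mathcal S\subseteq\mathbb R^{n_s}$ and action space $\mathcal A\subseteq\mathbb R^{n_a}$, and transition density $\rho[\boldsymbol{s}^+\,|\,\boldsymbol{s},\boldsymbol{a}]:\mathcal S\times\mathcal S\times\mathcal A\to[0,\infty)$ giving the conditional probability density of moving from the state-action pair $(\boldsymbol{s},\boldsymbol{a})$ to the successor state $\boldsymbol{s}^+$. The stage cost $\ell:\mathcal S\times\mathcal A\to\mathbb R$ and the terminal cost $\ell_N$ on $\mathcal S$ are finite. $N\in\mathbb N$, $N\neq 0$, is the mission duration, and $\mathbb S\subseteq\mathcal S$ is the constraint (safe) set; initial states satisfy $\boldsymbol{s}_0\in\mathbb S$. Policies: a deterministic Markovian policy at time $k$ is a function $\boldsymbol{\pi}_k:\mathcal S\to\mathcal A$, specifying the action $\boldsymbol{a}_k=\boldsymbol{\pi}_k(\boldsymbol{s}_k)$. A policy sequence is $\boldsymbol{\pi}=\{\boldsymbol{\pi}_0,\ldots,\boldsymbol{\pi}_{N-1}\}$, and $\boldsymbol{\pi}^k=\{\boldsymbol{\pi}_k,\ldots,\boldsymbol{\pi}_{N-1}\}$ denotes its tail (so $\boldsymbol{\pi}^0=\boldsymbol{\pi}$). $\mathbb E[\,\cdot\,|\,\boldsymbol{s}_0,\boldsymbol{\pi}]$ is the expectation over all possible state trajectories $\boldsymbol{s}_{0,\ldots,N}$ in closed loop with $\boldsymbol{\pi}$ from the fixed initial state $\boldsymbol{s}_0$, with $\boldsymbol{a}_k=\boldsymbol{\pi}_k(\boldsymbol{s}_k)$.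 Safety functions: $\mathbf 1_{\mathbb S}$ is the indicator function of $\mathbb S$. Set $V_N^{\boldsymbol{\pi}^N}(\boldsymbol{s})=V_N(\boldsymbol{s})=\mathbf 1_{\mathbb S}(\boldsymbol{s})$ and, for $k=0,\ldots,N-1$, $$V_k^{\boldsymbol{\pi}^k}(\boldsymbol{s})=\mathbb P\big[\boldsymbol{s}_{k+1},\ldots,\boldsymbol{s}_N\in\mathbb S\,\big|\,\boldsymbol{s}_k=\boldsymbol{s},\boldsymbol{\pi}^k\big],\qquad V_k^{\boldsymbol{\pi}^k}:\mathbb S\to[0,1],$$ and $V_0^{\boldsymbol{\pi}}=V_0^{\boldsymbol{\pi}^0}$. The operator $\mathbb E_{\boldsymbol{s}_{k+1}}$ is the expectation taken with respect to the probability distribution of $\boldsymbol{s}_{k+1}$ that remains in $\mathbb S$: $$\mathbb E_{\boldsymbol{s}_{k+1}}\big[g(\boldsymbol{s}_{k+1})\,\big|\,\boldsymbol{s}_k,\boldsymbol{\pi}_k(\boldsymbol{s}_k)\big]=\int_{\mathbb S}g(\boldsymbol{s}_{k+1})\,\rho[\boldsymbol{s}_{k+1}\,|\,\boldsymbol{s}_k,\boldsymbol{\pi}_k(\boldsymbol{s}_k)]\,\mathrm d\boldsymbol{s}_{k+1}.$$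
   Formalization: False if costs after leaving the safe set count: so either these have mean zero under every policy, or cost is counted only until first exit. Also assumed: measurable policies and data, no expected cost −∞ and no ∞−∞ with the penalty, minima in the recursion attained by a measurable policy. *)

theory Defs
  imports "HOL-Probability.Probability"
begin

record ('s, 'a) mission =
  states :: "'s set"
  actions :: "'a set"
  trans_density :: "'s \<Rightarrow> 's \<Rightarrow> 'a \<Rightarrow> real"  \<comment> \<open>successor state first\<close>
  stage_cost :: "'s \<Rightarrow> 'a \<Rightarrow> real"
  terminal_cost :: "'s \<Rightarrow> real"
  duration :: nat
  safe :: "'s set"

definition state_space :: "('s::euclidean_space, 'a::euclidean_space) mission \<Rightarrow> 's measure" where
  "state_space M = restrict_space borel (states M)"

definition action_space :: "('s::euclidean_space, 'a::euclidean_space) mission \<Rightarrow> 'a measure" where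
  "action_space M = restrict_space borel (actions M)"

definition valid_mission :: "('s::euclidean_space, 'a::euclidean_space) mission \<Rightarrow> bool" where
  "valid_mission M \<longleftrightarrow>
     0 < duration M \<and>
     states M \<in> sets borel \<and> safe M \<in> sets borel \<and> safe M \<subseteq> states M \<and>
     (\<forall>s'\<in>states M. \<forall>s\<in>states M. \<forall>a\<in>actions M. 0 \<le> trans_density M s' s a) \<and>
     (\<lambda>(s', s, a). trans_density M s' s a)
        \<in> borel_measurable (state_space M \<Otimes>\<^sub>M (state_space M \<Otimes>\<^sub>M action_space M)) \<and>
     (\<forall>s\<in>states M. \<forall>a\<in>actions M.
        (\<integral>\<^sup>+s'\<in>states M. ennreal (trans_density M s' s a) \<partial>lborel) = 1) \<and>
     (\<lambda>(s, a). stage_cost M s a) \<in> borel_measurable (state_space M \<Otimes>\<^sub>M action_space M) \<and>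
     terminal_cost M \<in> borel_measurable (state_space M)"

text \<open>Only the entries \<open>\<pi> k\<close> with \<open>k < duration M\<close> of a policy sequence matter, so the tail of
  a policy sequence from time \<open>k\<close> is represented by the same \<open>\<pi>\<close> together with \<open>k\<close>.\<close>

definition policies :: "('s::euclidean_space, 'a::euclidean_space) mission \<Rightarrow> (nat \<Rightarrow> 's \<Rightarrow> 'a) set" where
  "policies M = {\<pi>. \<forall>k<duration M. \<pi> k \<in> measurable (state_space M) (action_space M)}"

text \<open>The integral of an extended-real-valued function, with the convention \<open>\<infinity> - \<infinity> = \<infinity>\<close>
  (that of the library's \<open>ereal\<close>, and the usual one for minimization problems).
  It agrees with the Bochner integral on integrable functions.\<close>

definition xint :: "'b measure \<Rightarrow> ('b \<Rightarrow> ereal) \<Rightarrow> ereal" where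
  "xint M f = enn2ereal (\<integral>\<^sup>+x. e2ennreal (f x) \<partial>M) - enn2ereal (\<integral>\<^sup>+x. e2ennreal (- f x) \<partial>M)"

lemma xint_eq_integral:
  assumes "integrable M f"
  shows "xint M (\<lambda>x. ereal (f x)) = ereal (\<integral>x. f x \<partial>M)"
proof -
  have *: "(\<integral>\<^sup>+x. ennreal (f x) \<partial>M) < \<infinity>" "(\<integral>\<^sup>+x. ennreal (- f x) \<partial>M) < \<infinity>"
    using assms by (auto simp: real_integrable_def less_top)
  have "xint M (\<lambda>x. ereal (f x))
      = enn2ereal (\<integral>\<^sup>+x. ennreal (f x) \<partial>M) - enn2ereal (\<integral>\<^sup>+x. ennreal (- f x) \<partial>M)"
    by (simp add: xint_def e2ennreal_ereal)
  with * show ?thesis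
    by (simp add: real_lebesgue_integral_def[OF assms])
       (cases "\<integral>\<^sup>+x. ennreal (f x) \<partial>M"; cases "\<integral>\<^sup>+x. ennreal (- f x) \<partial>M";
        simp add: enn2ereal_ennreal)
qed

text \<open>Law of \<open>(s\<^sub>k, \<dots>, s\<^sub>k\<^sub>+\<^sub>m)\<close>, indexed by absolute time, given \<open>s\<^sub>k = s\<close>.\<close>

definition kernel :: "('s::euclidean_space, 'a::euclidean_space) mission \<Rightarrow> 's \<Rightarrow> 'a \<Rightarrow> 's measure" where
  "kernel M s a = density (restrict_space lborel (states M)) (\<lambda>s'. ennreal (trans_density M s' s a))"

primrec steps_law ::
    "('s::euclidean_space, 'a::euclidean_space) mission \<Rightarrow> (nat \<Rightarrow> 's \<Rightarrow> 'a) \<Rightarrow> nat \<Rightarrow> nat \<Rightarrow> 's \<Rightarrow> (nat \<Rightarrow> 's) measure" where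
  "steps_law M \<pi> 0 k s = return (\<Pi>\<^sub>M i\<in>{k..k}. state_space M) (\<lambda>i\<in>{k}. s)"
| "steps_law M \<pi> (Suc m) k s =
     kernel M s (\<pi> k s) \<bind>
       (\<lambda>s'. distr (steps_law M \<pi> m (Suc k) s') (\<Pi>\<^sub>M i\<in>{k..k + Suc m}. state_space M) (\<lambda>\<omega>. fun_upd \<omega> k s))"

definition path_law ::
    "('s::euclidean_space, 'a::euclidean_space) mission \<Rightarrow> (nat \<Rightarrow> 's \<Rightarrow> 'a) \<Rightarrow> nat \<Rightarrow> 's \<Rightarrow> (nat \<Rightarrow> 's) measure" where
  "path_law M \<pi> k s = steps_law M \<pi> (duration M - k) k s"

definition V :: "('s::euclidean_space, 'a::euclidean_space) mission \<Rightarrow> (nat \<Rightarrow> 's \<Rightarrow> 'a) \<Rightarrow> nat \<Rightarrow> 's \<Rightarrow> real" where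
  "V M \<pi> k s =
     (if k = duration M then indicator (safe M) s
      else \<P>(\<omega> in path_law M \<pi> k s. \<forall>i\<in>{k<..duration M}. \<omega> i \<in> safe M))"

text \<open>The expectation over the part of the successor law that remains in the safe set, for
  real-valued and for extended-real-valued functions.\<close>

definition safe_expectation ::
    "('s::euclidean_space, 'a::euclidean_space) mission \<Rightarrow> 's \<Rightarrow> 'a \<Rightarrow> ('s \<Rightarrow> real) \<Rightarrow> real" where
  "safe_expectation M s a g = (LINT s':safe M|lborel. g s' * trans_density M s' s a)"

definition safe_xexpectation ::
    "('s::euclidean_space, 'a::euclidean_space) mission \<Rightarrow> 's \<Rightarrow> 'a \<Rightarrow> ('s \<Rightarrow> ereal) \<Rightarrow> ereal" where
  "safe_xexpectation M s a g =
     xint (restrict_space lborel (safe M)) (\<lambda>s'. g s' * ereal (trans_density M s' s a))"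

definition commutes :: "('s::euclidean_space, 'a::euclidean_space) mission \<Rightarrow> (real \<Rightarrow> ereal) \<Rightarrow> bool" where
  "commutes M \<zeta> \<longleftrightarrow>
     (\<forall>\<pi>\<in>policies M. \<forall>k<duration M. \<forall>s\<in>safe M.
        \<zeta> (V M \<pi> k s) = \<zeta> (safe_expectation M s (\<pi> k s) (V M \<pi> (Suc k))) \<and>
        \<zeta> (safe_expectation M s (\<pi> k s) (V M \<pi> (Suc k))) =
          safe_xexpectation M s (\<pi> k s) (\<lambda>s'. \<zeta> (V M \<pi> (Suc k) s')))"

definition mission_cost ::
    "('s::euclidean_space, 'a::euclidean_space) mission \<Rightarrow> (nat \<Rightarrow> 's \<Rightarrow> 'a) \<Rightarrow> (nat \<Rightarrow> 's) \<Rightarrow> real" where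
  "mission_cost M \<pi> \<omega> =
     (\<Sum>i<duration M. stage_cost M (\<omega> i) (\<pi> i (\<omega> i))) + terminal_cost M (\<omega> (duration M))"

text \<open>The part of the cost from time \<open>k\<close> on that is incurred before the trajectory first leaves the
  safe set. Integrating the cost-to-go over the safe set only, as the dynamic programming recursion
  below does, discards everything that is incurred later, even if the trajectory returns.\<close>

definition cost_until_exit ::
    "('s::euclidean_space, 'a::euclidean_space) mission \<Rightarrow> nat \<Rightarrow> (nat \<Rightarrow> 's \<Rightarrow> 'a) \<Rightarrow> (nat \<Rightarrow> 's) \<Rightarrow> real" where
  "cost_until_exit M k \<pi> \<omega> =
     (\<Sum>i=k..<duration M.
        if \<forall>j\<in>{k<..i}. \<omega> j \<in> safe M then stage_cost M (\<omega> i) (\<pi> i (\<omega> i)) else 0) +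
     (if \<forall>j\<in>{k<..duration M}. \<omega> j \<in> safe M then terminal_cost M (\<omega> (duration M)) else 0)"

definition no_cost_after_exit :: "('s::euclidean_space, 'a::euclidean_space) mission \<Rightarrow> 's \<Rightarrow> bool" where
  "no_cost_after_exit M s\<^sub>0 \<longleftrightarrow>
     (\<forall>\<pi>\<in>policies M.
        integrable (path_law M \<pi> 0 s\<^sub>0) (\<lambda>\<omega>. mission_cost M \<pi> \<omega> - cost_until_exit M 0 \<pi> \<omega>) \<and>
        (\<integral>\<omega>. mission_cost M \<pi> \<omega> - cost_until_exit M 0 \<pi> \<omega> \<partial>path_law M \<pi> 0 s\<^sub>0) = 0)"

text \<open>No expectation of costs is \<open>-\<infinity>\<close>, and no sum of cost and penalty has the form \<open>\<infinity> - \<infinity>\<close>.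
  This holds for instance if costs and penalty are bounded below, and for an arbitrary penalty
  if the costs are bounded.\<close>

definition well_posed :: "('s::euclidean_space, 'a::euclidean_space) mission \<Rightarrow> (real \<Rightarrow> ereal) \<Rightarrow> bool" where
  "well_posed M \<zeta> \<longleftrightarrow>
     (\<forall>\<pi>\<in>policies M. \<forall>k<duration M. \<forall>s\<in>safe M.
        (\<integral>\<^sup>+\<omega>. ennreal (- cost_until_exit M k \<pi> \<omega>) \<partial>path_law M \<pi> k s) < \<infinity> \<and>
        ((\<integral>\<^sup>+\<omega>. ennreal (cost_until_exit M k \<pi> \<omega>) \<partial>path_law M \<pi> k s) < \<infinity> \<or>
         (\<integral>\<^sup>+s'\<in>safe M. e2ennreal (- \<zeta> (V M \<pi> (Suc k) s') * ereal (trans_density M s' s (\<pi> k s))) \<partial>lborel) < \<infinity>))"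

definition objective ::
    "('s::euclidean_space, 'a::euclidean_space) mission \<Rightarrow> (real \<Rightarrow> ereal) \<Rightarrow>
     ((nat \<Rightarrow> 's \<Rightarrow> 'a) \<Rightarrow> (nat \<Rightarrow> 's) \<Rightarrow> real) \<Rightarrow> 's \<Rightarrow> (nat \<Rightarrow> 's \<Rightarrow> 'a) \<Rightarrow> ereal" where
  "objective M \<zeta> cost s\<^sub>0 \<pi> =
     xint (path_law M \<pi> 0 s\<^sub>0) (\<lambda>\<omega>. ereal (cost \<pi> \<omega>)) + \<zeta> (V M \<pi> 0 s\<^sub>0)"

definition optimal_cost ::
    "('s::euclidean_space, 'a::euclidean_space) mission \<Rightarrow> (real \<Rightarrow> ereal) \<Rightarrow>
     ((nat \<Rightarrow> 's \<Rightarrow> 'a) \<Rightarrow> (nat \<Rightarrow> 's) \<Rightarrow> real) \<Rightarrow> 's \<Rightarrow> ereal" where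
  "optimal_cost M \<zeta> cost s\<^sub>0 = (INF \<pi>\<in>policies M. objective M \<zeta> cost s\<^sub>0 \<pi>)"

definition optimal_policy ::
    "('s::euclidean_space, 'a::euclidean_space) mission \<Rightarrow> (real \<Rightarrow> ereal) \<Rightarrow>
     ((nat \<Rightarrow> 's \<Rightarrow> 'a) \<Rightarrow> (nat \<Rightarrow> 's) \<Rightarrow> real) \<Rightarrow> 's \<Rightarrow> (nat \<Rightarrow> 's \<Rightarrow> 'a) \<Rightarrow> bool" where
  "optimal_policy M \<zeta> cost s\<^sub>0 \<pi> \<longleftrightarrow> is_arg_min (objective M \<zeta> cost s\<^sub>0) (\<lambda>\<pi>'. \<pi>' \<in> policies M) \<pi>"

definition dp_rhs ::
    "('s::euclidean_space, 'a::euclidean_space) mission \<Rightarrow> ('s \<Rightarrow> ereal) \<Rightarrow> 's \<Rightarrow> 'a \<Rightarrow> ereal" where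
  "dp_rhs M J s a = ereal (stage_cost M s a) + safe_xexpectation M s a J"

text \<open>\<open>dp_steps M \<zeta> m\<close> is the cost-to-go with \<open>m\<close> stages left.\<close>

primrec dp_steps ::
    "('s::euclidean_space, 'a::euclidean_space) mission \<Rightarrow> (real \<Rightarrow> ereal) \<Rightarrow> nat \<Rightarrow> 's \<Rightarrow> ereal" where
  "dp_steps M \<zeta> 0 s = ereal (terminal_cost M s) + \<zeta> (indicator (safe M) s)"
| "dp_steps M \<zeta> (Suc m) s = (INF a\<in>actions M. dp_rhs M (dp_steps M \<zeta> m) s a)"

definition dp_value ::
    "('s::euclidean_space, 'a::euclidean_space) mission \<Rightarrow> (real \<Rightarrow> ereal) \<Rightarrow> nat \<Rightarrow> 's \<Rightarrow> ereal" where
  "dp_value M \<zeta> k s = dp_steps M \<zeta> (duration M - k) s"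

definition dp_minimizer ::
    "('s::euclidean_space, 'a::euclidean_space) mission \<Rightarrow> (real \<Rightarrow> ereal) \<Rightarrow> (nat \<Rightarrow> 's \<Rightarrow> 'a) \<Rightarrow> bool" where
  "dp_minimizer M \<zeta> \<pi> \<longleftrightarrow>
     \<pi> \<in> policies M \<and>
     (\<forall>k<duration M. \<forall>s\<in>safe M.
        is_arg_min (dp_rhs M (dp_value M \<zeta> (Suc k)) s) (\<lambda>a. a \<in> actions M) (\<pi> k s))"

end

theory Submission
  imports Defs
begin

text \<open>
  Fix a policy sequence and let \<open>W\<^sub>k(s)\<close> be the expected cost incurred from time \<open>k\<close> until the
  trajectory leaves the safe set, plus the penalty \<open>\<zeta>(V\<^sub>k(s))\<close>. Conditioning on the next state shows
  that the expected cost at time \<open>k\<close> is the stage cost plus the integral over the safe set of the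
  expected cost at time \<open>k + 1\<close> (\<open>expected_cost_Suc\<close>). The commutation hypothesis says that the
  penalty satisfies the same equation without a stage cost. Adding the two, \<open>W\<^sub>k\<close> equals the right-hand
  side of the dynamic programming recursion, evaluated at \<open>W\<^sub>k\<^sub>+\<^sub>1\<close> and at the action of the policy
  (\<open>policy_value_Suc\<close>): a penalty on a probability of the whole trajectory has become a Markovian
  terminal cost.

  From here the classical argument applies. The right-hand side of the recursion is monotone in the
  cost-to-go, so backward induction gives \<open>J\<^sub>k \<le> W\<^sub>k\<close> for every policy (\<open>dp_value_le_policy_value\<close>),
  with equality for a policy that attains all the minima (\<open>policy_value_minimizer\<close>). At \<open>k = 0\<close> this
  says that such a policy is optimal and that the optimal cost is \<open>J\<^sub>0\<close>. If the costs incurred after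
  leaving the safe set have mean zero, the cost of the whole mission gives the same objective
  (\<open>objective_mission_cost\<close>).

  The delicate point is the addition, since the penalty may be infinite and the extended integral
  \<open>xint\<close> is not additive in general. It is additive if one summand has a finite negative part and
  moreover the positive part of that summand or the negative part of the other one is finite
  (\<open>xint_add\<close>), and that is what well-posedness provides.
\<close>

section \<open>Additivity and monotonicity of the extended integral\<close>

lemma xint_cong: "(\<And>x. x \<in> space M \<Longrightarrow> f x = g x) \<Longrightarrow> xint M f = xint M g"
  unfolding xint_def by (metis (mono_tags, lifting) nn_integral_cong)

lemma xint_cong_AE: "AE x in M. f x = g x \<Longrightarrow> xint M f = xint M g"
  unfolding xint_def
  by (intro arg_cong2[where f="(-)"] arg_cong[where f=enn2ereal] nn_integral_cong_AE) auto

lemma xint_mono: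
  assumes "\<And>x. x \<in> space M \<Longrightarrow> f x \<le> g x"
  shows "xint M f \<le> xint M g"
  unfolding xint_def
  by (intro ereal_minus_mono) (auto simp flip: less_eq_ennreal.rep_eq intro!: nn_integral_mono e2ennreal_mono assms)

text \<open>Splitting \<open>a\<close>, \<open>b\<close> and their sum into positive and negative parts and moving the negative parts
  to the other side turns a triviality into an identity in \<open>ennreal\<close>. It survives all infinite cases, including \<open>\<infinity> - \<infinity> = \<infinity>\<close>, so that it can be
  integrated without any exceptional set.\<close>

lemma positive_part_add:
  "e2ennreal (a + b) + e2ennreal (- a) + e2ennreal (- b)
    = e2ennreal (- (a + b)) + e2ennreal a + e2ennreal b"
  apply (cases a; cases b; simp)
  subgoal for x y
    by (cases "0 \<le> x"; cases "0 \<le> y"; cases "0 \<le> x + y")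
       (auto simp: ennreal_neg ennreal_plus[symmetric] simp del: ennreal_plus)
  done

lemma positive_part_add_le: "e2ennreal (a + b) \<le> e2ennreal a + e2ennreal b"
  apply (cases a; cases b; simp)
  subgoal for x y
    by (cases "0 \<le> x"; cases "0 \<le> y"; cases "0 \<le> x + y")
       (auto simp: ennreal_neg ennreal_plus[symmetric] simp del: ennreal_plus intro!: ennreal_leI)
  done

lemma negative_part_add_le: "e2ennreal (- (a + b)) \<le> e2ennreal (- a) + e2ennreal (- b)"
  apply (cases a; cases b; simp)
  subgoal for x y
    by (cases "0 \<le> x"; cases "0 \<le> y"; cases "0 \<le> x + y")
       (auto simp: ennreal_neg ennreal_plus[symmetric] simp del: ennreal_plus intro!: ennreal_leI)
  done

lemma positive_part_le_add: "e2ennreal b \<le> e2ennreal (a + b) + e2ennreal (- a)"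
  apply (cases a; cases b; simp)
  subgoal for x y
    by (cases "0 \<le> x"; cases "0 \<le> y"; cases "0 \<le> x + y")
       (auto simp: ennreal_neg ennreal_plus[symmetric] simp del: ennreal_plus intro!: ennreal_leI)
  done

text \<open>The arithmetic behind \<open>xint_add\<close>: here \<open>A, B\<close> are the integrated parts of a sum, \<open>fp, fn\<close> and
  \<open>gp, gn\<close> those of the summands. If all are finite, the claim is the first equation; the
  inequalities decide which of \<open>A\<close> and \<open>B\<close> are infinite when some of the others are.\<close>

lemma enn2ereal_diff_eqI:
  fixes A B fp fn gp gn :: ennreal
  assumes eq: "A + fn + gn = B + fp + gp"
    and "A \<le> fp + gp" "B \<le> fn + gn" "gp \<le> A + fn" "fp \<le> A + gn"
    and "fn < \<infinity>" "fp < \<infinity> \<or> gn < \<infinity>"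
  shows "enn2ereal A - enn2ereal B = (enn2ereal fp - enn2ereal fn) + (enn2ereal gp - enn2ereal gn)"
  using assms
  apply (cases A; cases B; cases fp; cases fn; cases gp; cases gn)
  apply (simp_all add: enn2ereal_ennreal top_unique flip: ennreal_plus)
  done

text \<open>In contrast to general distributivity on \<open>ereal\<close>, a finite nonnegative factor is harmless even for
  \<open>\<infinity> - \<infinity>\<close>.\<close>

lemma distrib_right_ereal_nonneg:
  assumes "0 \<le> r"
  shows "(a + b) * ereal r = a * ereal r + b * ereal r"
  using assms by (cases "r = 0"; cases a; cases b) (auto simp: field_simps)

lemma diff_mult_ereal:
  assumes "0 \<le> r"
  shows "(enn2ereal p - enn2ereal q) * ereal r = enn2ereal (p * ennreal r) - enn2ereal (q * ennreal r)"
  using assms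
  by (cases "r = 0"; cases p; cases q)
     (auto simp: enn2ereal_ennreal ennreal_mult[symmetric] ennreal_top_mult zero_ennreal.rep_eq field_simps)

lemma parts_of_difference:
  "e2ennreal (enn2ereal p - enn2ereal q) \<le> p"
  "e2ennreal (- (enn2ereal p - enn2ereal q)) \<le> q"
proof -
  have "enn2ereal p - enn2ereal q \<le> enn2ereal p" "- (enn2ereal p - enn2ereal q) \<le> enn2ereal q"
    using enn2ereal_nonneg[of p] enn2ereal_nonneg[of q]
    by (cases "enn2ereal p"; cases "enn2ereal q"; simp)+
  from this[THEN e2ennreal_mono]
  show "e2ennreal (enn2ereal p - enn2ereal q) \<le> p" "e2ennreal (- (enn2ereal p - enn2ereal q)) \<le> q"
    by simp_all
qed

lemma ereal_of_parts: "enn2ereal (ennreal r) - enn2ereal (ennreal (- r)) = ereal r"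
  by (cases "0 \<le> r") (auto simp: ennreal_neg enn2ereal_ennreal zero_ennreal.rep_eq)

lemma ennreal_le_add_split: "x \<le> y + z \<Longrightarrow> ennreal x \<le> ennreal y + ennreal z"
  using e2ennreal_mono[of "ereal x" "ereal y + ereal z"] positive_part_add_le[of "ereal y" "ereal z"] by simp

text \<open>The asymmetry of the hypotheses reflects the convention \<open>\<infinity> - \<infinity> = \<infinity>\<close>. If \<open>f\<close> is integrable, \<open>g\<close> may
  be arbitrary, even with both parts of infinite integral. If only the negative part of \<open>f\<close> is
  integrable, the negative part of \<open>g\<close> has to be controlled, as it could otherwise cancel an infinite
  positive part of \<open>f\<close> pointwise.\<close>

lemma xint_add:
  assumes [measurable]: "f \<in> borel_measurable M" "g \<in> borel_measurable M"
    and fn: "(\<integral>\<^sup>+x. e2ennreal (- f x) \<partial>M) < \<infinity>"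
    and "(\<integral>\<^sup>+x. e2ennreal (f x) \<partial>M) < \<infinity> \<or> (\<integral>\<^sup>+x. e2ennreal (- g x) \<partial>M) < \<infinity>"
  shows "xint M (\<lambda>x. f x + g x) = xint M f + xint M g"
  unfolding xint_def
proof (rule enn2ereal_diff_eqI)
  let ?p = "\<lambda>h. \<integral>\<^sup>+x. e2ennreal (h x) \<partial>M"
  let ?h = "\<lambda>x. f x + g x"
  have "?p ?h + ?p (\<lambda>x. - f x) + ?p (\<lambda>x. - g x)
      = (\<integral>\<^sup>+x. e2ennreal (?h x) + e2ennreal (- f x) + e2ennreal (- g x) \<partial>M)"
    by (simp add: nn_integral_add)
  also have "\<dots> = (\<integral>\<^sup>+x. e2ennreal (- ?h x) + e2ennreal (f x) + e2ennreal (g x) \<partial>M)"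
    by (simp only: positive_part_add)
  also have "\<dots> = ?p (\<lambda>x. - ?h x) + ?p f + ?p g"
    by (simp add: nn_integral_add)
  finally show "?p ?h + ?p (\<lambda>x. - f x) + ?p (\<lambda>x. - g x) = ?p (\<lambda>x. - ?h x) + ?p f + ?p g" .
  show "?p ?h \<le> ?p f + ?p g"
    by (subst nn_integral_add[symmetric]) (auto intro!: nn_integral_mono positive_part_add_le)
  show "?p (\<lambda>x. - ?h x) \<le> ?p (\<lambda>x. - f x) + ?p (\<lambda>x. - g x)"
    by (subst nn_integral_add[symmetric]) (auto intro!: nn_integral_mono negative_part_add_le)
  show "?p g \<le> ?p ?h + ?p (\<lambda>x. - f x)"
    by (subst nn_integral_add[symmetric]) (auto intro!: nn_integral_mono positive_part_le_add)
  show "?p f \<le> ?p ?h + ?p (\<lambda>x. - g x)"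
    by (subst nn_integral_add[symmetric])
       (auto intro!: nn_integral_mono positive_part_le_add simp: add.commute[of "f _"])
qed (use assms in auto)

lemma xint_diff_ennreal:
  assumes [measurable]: "p \<in> borel_measurable M" "q \<in> borel_measurable M"
    and q: "(\<integral>\<^sup>+x. q x \<partial>M) < \<infinity>"
  shows "xint M (\<lambda>x. enn2ereal (p x) - enn2ereal (q x))
    = enn2ereal (\<integral>\<^sup>+x. p x \<partial>M) - enn2ereal (\<integral>\<^sup>+x. q x \<partial>M)"
proof -
  have "xint M (\<lambda>x. - enn2ereal (q x) + enn2ereal (p x))
      = xint M (\<lambda>x. - enn2ereal (q x)) + xint M (\<lambda>x. enn2ereal (p x))"
    using q by (intro xint_add) (auto simp: e2ennreal_neg)
  then show ?thesis
    by (simp add: xint_def e2ennreal_neg minus_ereal_def zero_ennreal.rep_eq add.commute)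
qed

lemma xint_add_integrable:
  fixes f g :: "'b \<Rightarrow> real"
  assumes f: "integrable M f" and [measurable]: "g \<in> borel_measurable M"
  shows "xint M (\<lambda>x. ereal (f x + g x)) = ereal (\<integral>x. f x \<partial>M) + xint M (\<lambda>x. ereal (g x))"
proof -
  have "xint M (\<lambda>x. ereal (f x) + ereal (g x)) = xint M (\<lambda>x. ereal (f x)) + xint M (\<lambda>x. ereal (g x))"
    using f by (intro xint_add) (auto simp: real_integrable_def less_top)
  then show ?thesis
    by (simp add: xint_eq_integral[OF f])
qed

section \<open>The trajectory law under a fixed policy\<close>

locale controlled_mission =
  fixes M :: "('s::euclidean_space, 'a::euclidean_space) mission" and \<pi> :: "nat \<Rightarrow> 's \<Rightarrow> 'a"
  assumes valid: "valid_mission M" and policy: "\<pi> \<in> policies M"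
begin

abbreviation S where "S \<equiv> state_space M"
abbreviation paths where "paths k \<equiv> \<Pi>\<^sub>M i\<in>{k..duration M}. S"

lemma space_S [simp]: "space S = states M"
  by (simp add: state_space_def space_restrict_space)

lemma sets_lborel_states [measurable_cong]: "sets (restrict_space lborel (states M)) = sets S"
  unfolding state_space_def by (intro sets_restrict_space_cong) simp

lemma states_borel [measurable]: "states M \<in> sets borel"
  and safe_borel [measurable]: "safe M \<in> sets borel"
  and safe_subset: "safe M \<subseteq> states M"
  using valid by (auto simp: valid_mission_def)

lemma safe_S [measurable]: "safe M \<in> sets S"
  unfolding state_space_def using safe_borel safe_subset by (auto simp: sets_restrict_space)

lemma singleton_S: "s \<in> states M \<Longrightarrow> {s} \<in> sets S"
  unfolding state_space_def by (auto simp: sets_restrict_space image_iff intro!: bexI[of _ "{s}"])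

lemma policy_measurable [measurable]: "k < duration M \<Longrightarrow> \<pi> k \<in> S \<rightarrow>\<^sub>M action_space M"
  using policy by (simp add: policies_def)

lemma action_in: "k < duration M \<Longrightarrow> s \<in> states M \<Longrightarrow> \<pi> k s \<in> actions M"
  using measurable_space[OF policy_measurable] by (simp add: action_space_def space_restrict_space)

lemma density_measurable:
  assumes [measurable]: "k < duration M"
  shows "(\<lambda>(s, s'). trans_density M s' s (\<pi> k s)) \<in> borel_measurable (S \<Otimes>\<^sub>M S)"
proof -
  have *: "(\<lambda>(s', s, a). trans_density M s' s a) \<in> borel_measurable (S \<Otimes>\<^sub>M (S \<Otimes>\<^sub>M action_space M))"
    using valid by (simp add: valid_mission_def)
  have "(\<lambda>(s, s'). (s', s, \<pi> k s)) \<in> S \<Otimes>\<^sub>M S \<rightarrow>\<^sub>M S \<Otimes>\<^sub>M (S \<Otimes>\<^sub>M action_space M)"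
    by measurable
  from measurable_compose[OF this *] show ?thesis
    by (simp add: case_prod_beta')
qed

lemma density_section_measurable:
  assumes "k < duration M" "s \<in> states M"
  shows "(\<lambda>s'. trans_density M s' s (\<pi> k s)) \<in> borel_measurable S"
  using measurable_compose[OF measurable_Pair1' density_measurable[OF assms(1)], of s] assms by simp

lemma trans_density_nonneg:
  "k < duration M \<Longrightarrow> s \<in> states M \<Longrightarrow> s' \<in> states M \<Longrightarrow> 0 \<le> trans_density M s' s (\<pi> k s)"
  using valid action_in by (simp add: valid_mission_def)

lemma nn_integral_kernel:
  assumes "k < duration M" "s \<in> states M" "f \<in> borel_measurable S"
  shows "(\<integral>\<^sup>+s'. f s' \<partial>kernel M s (\<pi> k s))
    = (\<integral>\<^sup>+s'. ennreal (trans_density M s' s (\<pi> k s)) * f s' \<partial>restrict_space lborel (states M))"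
  unfolding kernel_def using assms density_section_measurable[of k s]
  by (subst nn_integral_density) (auto cong: measurable_cong_sets)

text \<open>Links the probabilistic side, an expectation over the successor state, with the integral over the
  safe set that occurs in the dynamic programming recursion.\<close>

lemma nn_integral_kernel_safe:
  assumes "k < duration M" "s \<in> states M" "f \<in> borel_measurable S"
  shows "(\<integral>\<^sup>+s'. indicator (safe M) s' * f s' \<partial>kernel M s (\<pi> k s))
    = (\<integral>\<^sup>+s'. f s' * ennreal (trans_density M s' s (\<pi> k s)) \<partial>restrict_space lborel (safe M))"
proof -
  have "(\<lambda>s'. indicator (safe M) s' * f s') \<in> borel_measurable S"
    using assms by measurable
  then show ?thesis
    using assms safe_subset
    by (auto simp: nn_integral_kernel nn_integral_restrict_space indicator_def mult.commute intro!: nn_integral_cong)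
qed

lemma sets_kernel_S: "sets (kernel M s a) = sets S"
  by (simp add: kernel_def sets_lborel_states)

lemma kernel_measurable [measurable]:
  assumes k: "k < duration M"
  shows "(\<lambda>s. kernel M s (\<pi> k s)) \<in> S \<rightarrow>\<^sub>M prob_algebra S"
proof -
  let ?R = "restrict_space lborel (states M)"
  interpret R: sigma_finite_measure ?R
    by (intro sigma_finite_measure_restrict_space lborel.sigma_finite_measure_axioms) simp
  have prob: "prob_space (kernel M s (\<pi> k s))" if s: "s \<in> states M" for s
  proof
    have "space (kernel M s (\<pi> k s)) = space S"
      by (rule sets_eq_imp_space_eq[OF sets_kernel_S])
    then have "emeasure (kernel M s (\<pi> k s)) (space (kernel M s (\<pi> k s)))
        = (\<integral>\<^sup>+s'. 1 \<partial>kernel M s (\<pi> k s))" by simp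
    also have "\<dots> = (\<integral>\<^sup>+s'\<in>states M. ennreal (trans_density M s' s (\<pi> k s)) \<partial>lborel)"
      using k s by (subst nn_integral_kernel) (simp_all add: nn_integral_restrict_space)
    also have "\<dots> = 1"
      using valid s action_in[OF k s] by (simp add: valid_mission_def)
    finally show "emeasure (kernel M s (\<pi> k s)) (space (kernel M s (\<pi> k s))) = 1" .
  qed
  show ?thesis
  proof (intro measurable_prob_algebraI measurable_subprob_algebra)
    fix A assume A: "A \<in> sets S"
    have "(\<lambda>s. emeasure (kernel M s (\<pi> k s)) A) \<in> borel_measurable S \<longleftrightarrow>
        (\<lambda>s. \<integral>\<^sup>+s'. ennreal (trans_density M s' s (\<pi> k s)) * indicator A s' \<partial>?R) \<in> borel_measurable S"
    proof (intro measurable_cong)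
      fix s assume "s \<in> space S"
      then show "emeasure (kernel M s (\<pi> k s)) A
          = (\<integral>\<^sup>+s'. ennreal (trans_density M s' s (\<pi> k s)) * indicator A s' \<partial>?R)"
        using nn_integral_kernel[OF k, of s "indicator A"] A by (simp add: sets_kernel_S)
    qed
    also have "\<dots>"
    proof (rule R.borel_measurable_nn_integral)
      have "(\<lambda>(s, s'). ennreal (trans_density M s' s (\<pi> k s)) * indicator A s') \<in> borel_measurable (S \<Otimes>\<^sub>M S)"
        using density_measurable[OF k] A by measurable
      then show "(\<lambda>(s, s'). ennreal (trans_density M s' s (\<pi> k s)) * indicator A s') \<in> borel_measurable (S \<Otimes>\<^sub>M ?R)"
        by (simp cong: measurable_cong_sets sets_pair_measure_cong add: sets_lborel_states)
    qed
    finally show "(\<lambda>s. emeasure (kernel M s (\<pi> k s)) A) \<in> borel_measurable S" .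
  qed (use prob in \<open>auto intro: prob_space_imp_subprob_space simp: sets_kernel_S\<close>)
qed

text \<open>Measurable dependence on the initial state is what makes the \<open>bind\<close> in the definition of the law
  meaningful: without it, integrals over the law could not be disintegrated. That the values are
  probability measures comes with the target space.\<close>

lemma steps_law_measurable:
  "k + m \<le> duration M \<Longrightarrow> steps_law M \<pi> m k \<in> S \<rightarrow>\<^sub>M prob_algebra (\<Pi>\<^sub>M i\<in>{k..k + m}. S)"
proof (induction m arbitrary: k)
  case 0
  have "(\<lambda>s. return (\<Pi>\<^sub>M i\<in>{k..k}. S) (\<lambda>i\<in>{k}. s)) \<in> S \<rightarrow>\<^sub>M prob_algebra (\<Pi>\<^sub>M i\<in>{k..k}. S)"
  proof (rule measurable_compose[OF _ measurable_return_prob_space])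
    show "(\<lambda>s. \<lambda>i\<in>{k}. s) \<in> S \<rightarrow>\<^sub>M (\<Pi>\<^sub>M i\<in>{k..k}. S)"
      unfolding atLeastAtMost_singleton by (rule measurable_restrict) simp
  qed
  then show ?case by simp
next
  case (Suc m)
  have [measurable]: "steps_law M \<pi> m (Suc k) \<in> S \<rightarrow>\<^sub>M prob_algebra (\<Pi>\<^sub>M i\<in>{Suc k..Suc k + m}. S)"
    using Suc.IH[of "Suc k"] Suc.prems by simp
  have eq: "insert k {Suc k..Suc k + m} = {k..k + Suc m}" by auto
  have upd: "(\<lambda>(\<omega>, s). fun_upd \<omega> k s) \<in> (\<Pi>\<^sub>M i\<in>{Suc k..Suc k + m}. S) \<Otimes>\<^sub>M S \<rightarrow>\<^sub>M (\<Pi>\<^sub>M i\<in>{k..k + Suc m}. S)"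
    using measurable_add_dim[of k "{Suc k..Suc k + m}" "\<lambda>_. S"] unfolding eq .
  \<comment> \<open>The state that is prepended varies too, so the update has to be measurable jointly in it
    and the path.\<close>
  have upd': "(\<lambda>(x, \<omega>). fun_upd \<omega> k (fst x))
      \<in> (S \<Otimes>\<^sub>M S) \<Otimes>\<^sub>M (\<Pi>\<^sub>M i\<in>{Suc k..Suc k + m}. S) \<rightarrow>\<^sub>M (\<Pi>\<^sub>M i\<in>{k..k + Suc m}. S)"
  proof -
    have "(\<lambda>p. (snd p, fst (fst p))) \<in> (S \<Otimes>\<^sub>M S) \<Otimes>\<^sub>M (\<Pi>\<^sub>M i\<in>{Suc k..Suc k + m}. S)
        \<rightarrow>\<^sub>M (\<Pi>\<^sub>M i\<in>{Suc k..Suc k + m}. S) \<Otimes>\<^sub>M S"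
      by measurable
    from measurable_compose[OF this upd] show ?thesis
      by (simp add: case_prod_beta')
  qed
  have k: "k < duration M" using Suc.prems by simp
  show ?case
    unfolding steps_law.simps
  proof (rule measurable_bind_prob_space2[OF kernel_measurable[OF k]])
    show "(\<lambda>(s, s'). distr (steps_law M \<pi> m (Suc k) s') (\<Pi>\<^sub>M i\<in>{k..k + Suc m}. S) (\<lambda>\<omega>. fun_upd \<omega> k s))
        \<in> S \<Otimes>\<^sub>M S \<rightarrow>\<^sub>M prob_algebra (\<Pi>\<^sub>M i\<in>{k..k + Suc m}. S)"
      using measurable_distr_prob_space2[OF measurable_compose[OF measurable_snd
          \<open>steps_law M \<pi> m (Suc k) \<in> _\<close>] upd']
      by (simp add: case_prod_beta')
  qed
qed

lemma path_law_measurable [measurable]: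
  "k \<le> duration M \<Longrightarrow> path_law M \<pi> k \<in> S \<rightarrow>\<^sub>M prob_algebra (paths k)"
  using steps_law_measurable[of k "duration M - k"] by (simp add: path_law_def[abs_def])

lemma path_law_prob_algebra:
  "k \<le> duration M \<Longrightarrow> s \<in> states M \<Longrightarrow> path_law M \<pi> k s \<in> space (prob_algebra (paths k))"
  using measurable_space[OF path_law_measurable] by simp

lemma prob_space_path_law:
  "k \<le> duration M \<Longrightarrow> s \<in> states M \<Longrightarrow> prob_space (path_law M \<pi> k s)"
  using path_law_prob_algebra by (simp add: space_prob_algebra)

lemma sets_path_law:
  "k \<le> duration M \<Longrightarrow> s \<in> states M \<Longrightarrow> sets (path_law M \<pi> k s) = sets (paths k)"
  using path_law_prob_algebra by (simp add: space_prob_algebra)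

lemma space_path_law:
  "k \<le> duration M \<Longrightarrow> s \<in> states M \<Longrightarrow> space (path_law M \<pi> k s) = space (paths k)"
  using sets_path_law by (rule sets_eq_imp_space_eq)

lemma measurable_path_law:
  "k \<le> duration M \<Longrightarrow> s \<in> states M \<Longrightarrow> f \<in> borel_measurable (path_law M \<pi> k s) \<longleftrightarrow> f \<in> borel_measurable (paths k)"
  using sets_path_law by (intro arg_cong2[where f="(\<in>)"] measurable_cong_sets) auto

lemma prepend_measurable:
  assumes "k < duration M" "s \<in> states M"
  shows "(\<lambda>\<omega>. fun_upd \<omega> k s) \<in> paths (Suc k) \<rightarrow>\<^sub>M paths k"
proof -
  have "insert k {Suc k..duration M} = {k..duration M}" using assms by auto
  then have "(\<lambda>(\<omega>, s). fun_upd \<omega> k s) \<in> paths (Suc k) \<Otimes>\<^sub>M S \<rightarrow>\<^sub>M paths k"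
    using measurable_add_dim[of k "{Suc k..duration M}" "\<lambda>_. S"] by simp
  from measurable_compose[OF measurable_Pair2' this, of s] assms show ?thesis by simp
qed

lemma path_law_Suc:
  assumes "k < duration M"
  shows "path_law M \<pi> k s =
    kernel M s (\<pi> k s) \<bind> (\<lambda>s'. distr (path_law M \<pi> (Suc k) s') (paths k) (\<lambda>\<omega>. fun_upd \<omega> k s))"
proof -
  obtain m where m: "duration M = k + Suc m"
    using less_imp_Suc_add[OF assms] by auto
  then show ?thesis by (simp add: path_law_def)
qed

lemma prepended_law_measurable:
  assumes "k < duration M" "s \<in> states M"
  shows "(\<lambda>s'. distr (path_law M \<pi> (Suc k) s') (paths k) (\<lambda>\<omega>. fun_upd \<omega> k s))
    \<in> kernel M s (\<pi> k s) \<rightarrow>\<^sub>M prob_algebra (paths k)"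
proof -
  have "(\<lambda>s'. distr (path_law M \<pi> (Suc k) s') (paths k) (\<lambda>\<omega>. fun_upd \<omega> k s)) \<in> S \<rightarrow>\<^sub>M prob_algebra (paths k)"
    using assms by (intro measurable_compose[OF path_law_measurable] measurable_distr_prob_space prepend_measurable) auto
  then show ?thesis
    by (simp add: sets_kernel_S cong: measurable_cong_sets)
qed

lemma space_kernel_S: "space (kernel M s a) = states M"
  using sets_eq_imp_space_eq[OF sets_kernel_S] by simp

text \<open>The Markov property in integral form: condition on the state at time \<open>k + 1\<close>.\<close>

lemma nn_integral_path_law_Suc:
  assumes "k < duration M" "s \<in> states M" "F \<in> borel_measurable (paths k)"
  shows "(\<integral>\<^sup>+\<omega>. F \<omega> \<partial>path_law M \<pi> k s)
    = (\<integral>\<^sup>+s'. \<integral>\<^sup>+\<omega>. F (fun_upd \<omega> k s) \<partial>path_law M \<pi> (Suc k) s' \<partial>kernel M s (\<pi> k s))"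
proof -
  have "(\<integral>\<^sup>+\<omega>. F \<omega> \<partial>path_law M \<pi> k s)
      = (\<integral>\<^sup>+s'. \<integral>\<^sup>+\<omega>. F \<omega> \<partial>distr (path_law M \<pi> (Suc k) s') (paths k) (\<lambda>\<omega>. fun_upd \<omega> k s) \<partial>kernel M s (\<pi> k s))"
    using assms by (simp add: path_law_Suc nn_integral_bind[OF _ measurable_prob_algebraD[OF prepended_law_measurable]])
  also have "\<dots> = (\<integral>\<^sup>+s'. \<integral>\<^sup>+\<omega>. F (fun_upd \<omega> k s) \<partial>path_law M \<pi> (Suc k) s' \<partial>kernel M s (\<pi> k s))"
    using assms prepend_measurable[of k s]
    by (intro nn_integral_cong nn_integral_distr)
       (auto simp: space_kernel_S sets_path_law cong: measurable_cong_sets)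
  finally show ?thesis .
qed

lemma coordinate_measurable [measurable]:
  "k \<le> i \<Longrightarrow> i \<le> duration M \<Longrightarrow> (\<lambda>\<omega>. \<omega> i) \<in> paths k \<rightarrow>\<^sub>M S"
  by (rule measurable_component_singleton) simp

text \<open>Needed to evaluate, under the law started at time \<open>k\<close> in \<open>s\<close>, the stage cost at time \<open>k\<close> and the
  indicator that the state at time \<open>k\<close> is safe.\<close>

lemma AE_path_law_start:
  assumes "k \<le> duration M" "s \<in> states M"
  shows "AE \<omega> in path_law M \<pi> k s. \<omega> k = s"
proof -
  have pred: "Measurable.pred (paths k) (\<lambda>\<omega>. \<omega> k = s)"
  proof -
    have "{s} \<in> sets S" using assms singleton_S by simp
    then have "Measurable.pred (paths k) (\<lambda>\<omega>. \<omega> k \<in> {s})"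
      using coordinate_measurable[of k k] assms by (intro pred_sets2[where N=S]) auto
    then show ?thesis by simp
  qed
  show ?thesis
  proof (cases "k = duration M")
    case True
    then have law: "path_law M \<pi> k s = return (paths k) (\<lambda>i\<in>{k}. s)"
      by (simp add: path_law_def)
    have "(\<lambda>i\<in>{k}. s) \<in> space (paths k)"
      using True assms by (auto simp: space_PiM)
    from AE_return[OF this pred] show ?thesis
      unfolding law by simp
  next
    case False
    with assms have k: "k < duration M" by simp
    have "AE \<omega> in distr (path_law M \<pi> (Suc k) s') (paths k) (\<lambda>\<omega>. fun_upd \<omega> k s). \<omega> k = s"
      if "s' \<in> states M" for s'
    proof -
      have "(\<lambda>\<omega>. fun_upd \<omega> k s) \<in> path_law M \<pi> (Suc k) s' \<rightarrow>\<^sub>M paths k"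
        using prepend_measurable[OF k assms(2)] k that
        by (simp add: sets_path_law cong: measurable_cong_sets)
      then show ?thesis
        using pred by (subst AE_distr_iff) (auto simp: pred_def)
    qed
    then show ?thesis
      unfolding path_law_Suc[OF k]
      by (subst AE_bind[OF measurable_prob_algebraD[OF prepended_law_measurable[OF k assms(2)]] pred])
        (rule AE_I2, simp only: space_kernel_S)
  qed
qed

section \<open>Cost until exit and probability of safety\<close>

lemma stage_cost_measurable [measurable]:
  assumes "i < duration M"
  shows "(\<lambda>s. stage_cost M s (\<pi> i s)) \<in> borel_measurable S"
proof -
  have "(\<lambda>(s, a). stage_cost M s a) \<in> borel_measurable (S \<Otimes>\<^sub>M action_space M)"
    using valid by (simp add: valid_mission_def)
  from measurable_compose[OF measurable_Pair[OF measurable_ident policy_measurable[OF assms]] this]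
  show ?thesis by simp
qed

lemma terminal_cost_measurable [measurable]: "terminal_cost M \<in> borel_measurable S"
  using valid by (simp add: valid_mission_def)

lemma staying_safe_measurable:
  assumes "k \<le> i" "i \<le> duration M"
  shows "Measurable.pred (paths k) (\<lambda>\<omega>. \<forall>j\<in>{k<..i}. \<omega> j \<in> safe M)"
proof (rule pred_intros_finite)
  fix j assume "j \<in> {k<..i}"
  with assms show "Measurable.pred (paths k) (\<lambda>\<omega>. \<omega> j \<in> safe M)"
    by (intro pred_sets2[OF safe_S coordinate_measurable]) auto
qed simp

lemma cost_until_exit_measurable:
  assumes "k \<le> duration M"
  shows "cost_until_exit M k \<pi> \<in> borel_measurable (paths k)"
  unfolding cost_until_exit_def[abs_def]
proof (intro borel_measurable_add borel_measurable_sum)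
  fix i assume i: "i \<in> {k..<duration M}"
  then have "(\<lambda>\<omega>. stage_cost M (\<omega> i) (\<pi> i (\<omega> i))) \<in> borel_measurable (paths k)"
    by (intro measurable_compose[OF coordinate_measurable stage_cost_measurable]) auto
  with i staying_safe_measurable[of k i]
  show "(\<lambda>\<omega>. if \<forall>j\<in>{k<..i}. \<omega> j \<in> safe M then stage_cost M (\<omega> i) (\<pi> i (\<omega> i)) else 0) \<in> borel_measurable (paths k)"
    by (intro measurable_If) auto
next
  show "(\<lambda>\<omega>. if \<forall>j\<in>{k<..duration M}. \<omega> j \<in> safe M then terminal_cost M (\<omega> (duration M)) else 0) \<in> borel_measurable (paths k)"
    using assms staying_safe_measurable[of k "duration M"]
    by (intro measurable_If measurable_compose[OF coordinate_measurable terminal_cost_measurable]) auto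
qed

text \<open>The range is part of the claim because the penalty is measurable on the unit interval only.\<close>

lemma V_measurable:
  assumes "k \<le> duration M"
  shows "V M \<pi> k \<in> S \<rightarrow>\<^sub>M restrict_space borel {0..1}"
proof (cases "k = duration M")
  case True
  then show ?thesis
    by (auto simp: V_def[abs_def] indicator_def intro!: measurable_restrict_space2)
next
  case False
  let ?A = "{\<omega> \<in> space (paths k). \<forall>i\<in>{k<..duration M}. \<omega> i \<in> safe M}"
  have "?A \<in> sets (paths k)"
    using staying_safe_measurable[of k "duration M"] assms by simp
  then have "(\<lambda>s. measure (path_law M \<pi> k s) ?A) \<in> borel_measurable S"
    by (intro measurable_compose[OF path_law_measurable[OF assms]] measurable_measure_prob_algebra)
  moreover have "V M \<pi> k s = measure (path_law M \<pi> k s) ?A" if "s \<in> states M" for s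
    using False that assms by (simp add: V_def space_path_law)
  ultimately show ?thesis
    using prob_space.prob_le_1[OF prob_space_path_law[OF assms]]
    by (intro measurable_restrict_space2) (auto intro: measurable_cong[THEN iffD2])
qed

text \<open>Safety at time \<open>k\<close> itself is never tested by the cost from time \<open>k\<close> on, so the indicator of safety
  at time \<open>k + 1\<close> factors out of everything that is incurred later.\<close>

lemma cost_until_exit_Suc:
  assumes "k < duration M"
  shows "cost_until_exit M k \<pi> \<omega> = stage_cost M (\<omega> k) (\<pi> k (\<omega> k))
    + indicator (safe M) (\<omega> (Suc k)) * cost_until_exit M (Suc k) \<pi> \<omega>"
proof -
  have *: "(\<forall>j\<in>{k<..i}. \<omega> j \<in> safe M) \<longleftrightarrow> \<omega> (Suc k) \<in> safe M \<and> (\<forall>j\<in>{Suc k<..i}. \<omega> j \<in> safe M)"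
    if "Suc k \<le> i" for i
  proof -
    have "{k<..i} = insert (Suc k) {Suc k<..i}" using that by auto
    then show ?thesis by simp
  qed
  show ?thesis
    using assms
    by (simp add: cost_until_exit_def sum.atLeast_Suc_lessThan[OF assms] * indicator_def)
qed

lemma cost_until_exit_cong:
  assumes "k \<le> duration M" "\<And>i. k \<le> i \<Longrightarrow> \<omega> i = \<omega>' i"
  shows "cost_until_exit M k \<pi> \<omega> = cost_until_exit M k \<pi> \<omega>'"
  unfolding cost_until_exit_def using assms
  by (intro arg_cong2[where f="(+)"] sum.cong) auto

section \<open>The Bellman equation of a fixed policy\<close>

text \<open>Used with \<open>c = 1\<close> and \<open>c = - 1\<close>, for the positive and the negative part of the cost that is
  incurred from time \<open>k + 1\<close> on, provided the state at that time is safe.\<close>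

lemma nn_integral_continuation_cost:
  fixes c :: real
  assumes k: "k < duration M" and s: "s \<in> states M"
  shows "(\<integral>\<^sup>+\<omega>. ennreal (c * (indicator (safe M) (\<omega> (Suc k)) * cost_until_exit M (Suc k) \<pi> \<omega>)) \<partial>path_law M \<pi> k s)
    = (\<integral>\<^sup>+s'. (\<integral>\<^sup>+\<omega>. ennreal (c * cost_until_exit M (Suc k) \<pi> \<omega>) \<partial>path_law M \<pi> (Suc k) s')
          * ennreal (trans_density M s' s (\<pi> k s)) \<partial>restrict_space lborel (safe M))"
    (is "_ = (\<integral>\<^sup>+s'. ?G s' * _ \<partial>_)")
proof -
  let ?X = "cost_until_exit M (Suc k) \<pi>"
  have X: "?X \<in> borel_measurable (paths (Suc k))"
    using k by (intro cost_until_exit_measurable) simp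
  have upd: "?X (fun_upd \<omega> k s) = ?X \<omega>" for \<omega>
    using k by (intro cost_until_exit_cong) auto
  \<comment> \<open>The cost from time \<open>k + 1\<close> on factors through the projection that forgets time \<open>k\<close>.\<close>
  have restr: "(\<lambda>\<omega>. restrict \<omega> {Suc k..duration M}) \<in> paths k \<rightarrow>\<^sub>M paths (Suc k)"
    by (rule measurable_restrict_subset) auto
  have "?X (restrict \<omega> {Suc k..duration M}) = ?X \<omega>" for \<omega>
    using k unfolding cost_until_exit_def by (intro arg_cong2[where f="(+)"] sum.cong) auto
  then have X': "?X \<in> borel_measurable (paths k)"
    using measurable_compose[OF restr X] by simp
  have [measurable]: "(\<lambda>\<omega>. \<omega> (Suc k)) \<in> paths k \<rightarrow>\<^sub>M S"
    using k by (intro coordinate_measurable) auto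
  have G: "?G \<in> borel_measurable S"
    using X k by (intro measurable_compose[OF measurable_prob_algebraD[OF path_law_measurable]
        nn_integral_measurable_subprob_algebra]) auto
  have "(\<integral>\<^sup>+\<omega>. ennreal (c * (indicator (safe M) (\<omega> (Suc k)) * ?X \<omega>)) \<partial>path_law M \<pi> k s)
      = (\<integral>\<^sup>+s'. \<integral>\<^sup>+\<omega>. ennreal (c * (indicator (safe M) (\<omega> (Suc k)) * ?X \<omega>))
            \<partial>path_law M \<pi> (Suc k) s' \<partial>kernel M s (\<pi> k s))"
    using k s X' by (subst nn_integral_path_law_Suc) (simp_all add: upd)
  also have "\<dots> = (\<integral>\<^sup>+s'. indicator (safe M) s' * ?G s' \<partial>kernel M s (\<pi> k s))"
  proof (rule nn_integral_cong)
    fix s' assume "s' \<in> space (kernel M s (\<pi> k s))"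
    then have s': "s' \<in> states M" by (simp add: space_kernel_S)
    have "(\<integral>\<^sup>+\<omega>. ennreal (c * (indicator (safe M) (\<omega> (Suc k)) * ?X \<omega>)) \<partial>path_law M \<pi> (Suc k) s')
        = (\<integral>\<^sup>+\<omega>. indicator (safe M) s' * ennreal (c * ?X \<omega>) \<partial>path_law M \<pi> (Suc k) s')"
      using AE_path_law_start[of "Suc k" s'] k s'
      by (intro nn_integral_cong_AE) (auto simp: indicator_def)
    also have "\<dots> = indicator (safe M) s' * ?G s'"
      using X k s' by (intro nn_integral_cmult) (auto simp: measurable_path_law)
    finally show "(\<integral>\<^sup>+\<omega>. ennreal (c * (indicator (safe M) (\<omega> (Suc k)) * ?X \<omega>)) \<partial>path_law M \<pi> (Suc k) s')
        = indicator (safe M) s' * ?G s'" .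
  qed
  also have "\<dots> = (\<integral>\<^sup>+s'. ?G s' * ennreal (trans_density M s' s (\<pi> k s)) \<partial>restrict_space lborel (safe M))"
    using k s G by (rule nn_integral_kernel_safe)
  finally show ?thesis .
qed

definition expected_cost :: "nat \<Rightarrow> 's \<Rightarrow> ereal" where
  "expected_cost k s = xint (path_law M \<pi> k s) (\<lambda>\<omega>. ereal (cost_until_exit M k \<pi> \<omega>))"

definition policy_value :: "(real \<Rightarrow> ereal) \<Rightarrow> nat \<Rightarrow> 's \<Rightarrow> ereal" where
  "policy_value \<zeta> k s = expected_cost k s + \<zeta> (V M \<pi> k s)"

text \<open>Transfers measurability from the state space to the space over which \<open>safe_xexpectation\<close>
  integrates.\<close>

lemma measurable_safe: "f \<in> borel_measurable S \<Longrightarrow> f \<in> borel_measurable (restrict_space lborel (safe M))"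
proof -
  assume f: "f \<in> borel_measurable S"
  have "f \<in> borel_measurable (restrict_space borel (safe M))"
    using f safe_subset unfolding state_space_def by (rule measurable_restrict_mono)
  moreover have "sets (restrict_space lborel (safe M)) = sets (restrict_space borel (safe M))"
    by (intro sets_restrict_space_cong) simp
  ultimately show ?thesis by (simp cong: measurable_cong_sets)
qed

text \<open>Well-posedness is stated for the costs of whole trajectories, whereas additivity is needed for
  the expected continuation cost \<open>C\<close> as a function of the successor state. The last two claims
  transfer the finiteness: the parts of \<open>C\<close> are dominated by the conditional expectations of the parts of the
  continuation cost, and removing the finite stage cost does not affect finiteness.\<close>

lemma expected_cost_Suc:
  assumes k: "k < duration M" and s: "s \<in> states M"
    and neg: "(\<integral>\<^sup>+\<omega>. ennreal (- cost_until_exit M k \<pi> \<omega>) \<partial>path_law M \<pi> k s) < \<infinity>"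
  defines "C \<equiv> \<lambda>s'. expected_cost (Suc k) s' * ereal (trans_density M s' s (\<pi> k s))"
  shows "expected_cost k s = ereal (stage_cost M s (\<pi> k s)) + safe_xexpectation M s (\<pi> k s) (expected_cost (Suc k))"
    and "C \<in> borel_measurable (restrict_space lborel (safe M))"
    and "(\<integral>\<^sup>+s'. e2ennreal (- C s') \<partial>restrict_space lborel (safe M)) < \<infinity>"
    and "(\<integral>\<^sup>+\<omega>. ennreal (cost_until_exit M k \<pi> \<omega>) \<partial>path_law M \<pi> k s) < \<infinity> \<Longrightarrow>
      (\<integral>\<^sup>+s'. e2ennreal (C s') \<partial>restrict_space lborel (safe M)) < \<infinity>"
proof -
  let ?P = "path_law M \<pi> k s" and ?R = "restrict_space lborel (safe M)"
  let ?X = "cost_until_exit M (Suc k) \<pi>" and ?l = "stage_cost M s (\<pi> k s)"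
  let ?\<rho> = "\<lambda>s'. trans_density M s' s (\<pi> k s)"
  interpret prob_space ?P using k s by (intro prob_space_path_law) auto
  \<comment> \<open>\<open>U\<close> is the cost after time \<open>k\<close>; \<open>p\<close> and \<open>q\<close> are the conditional expectations of its positive
    and negative part given a safe successor state, weighted by the transition density.\<close>
  define U where "U \<omega> = indicator (safe M) (\<omega> (Suc k)) * ?X \<omega>" for \<omega>
  define p where "p s' = (\<integral>\<^sup>+\<omega>. ennreal (?X \<omega>) \<partial>path_law M \<pi> (Suc k) s') * ennreal (?\<rho> s')" for s'
  define q where "q s' = (\<integral>\<^sup>+\<omega>. ennreal (- ?X \<omega>) \<partial>path_law M \<pi> (Suc k) s') * ennreal (?\<rho> s')" for s'
  have start: "AE \<omega> in ?P. cost_until_exit M k \<pi> \<omega> = ?l + U \<omega>"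
    using AE_path_law_start[of k s] k s by (auto simp: cost_until_exit_Suc U_def)
  have cost: "cost_until_exit M k \<pi> \<in> borel_measurable ?P"
    using k s by (simp add: measurable_path_law cost_until_exit_measurable)
  have U: "U \<in> borel_measurable ?P"
  proof -
    have "(\<lambda>\<omega>. cost_until_exit M k \<pi> \<omega> - stage_cost M (\<omega> k) (\<pi> k (\<omega> k))) \<in> borel_measurable ?P"
      using cost k s measurable_compose[OF coordinate_measurable stage_cost_measurable, of k k k]
      by (auto simp: measurable_path_law)
    then show ?thesis
      using k by (simp add: cost_until_exit_Suc U_def[abs_def])
  qed
  have Up: "(\<integral>\<^sup>+\<omega>. ennreal (U \<omega>) \<partial>?P) = (\<integral>\<^sup>+s'. p s' \<partial>?R)"
    using nn_integral_continuation_cost[OF k s, of 1] by (simp add: U_def p_def)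
  have Uq: "(\<integral>\<^sup>+\<omega>. ennreal (- U \<omega>) \<partial>?P) = (\<integral>\<^sup>+s'. q s' \<partial>?R)"
    using nn_integral_continuation_cost[OF k s, of "-1"] by (simp add: U_def q_def)
  have X: "?X \<in> borel_measurable (paths (Suc k))"
    using k by (intro cost_until_exit_measurable) simp
  have \<rho>: "(\<lambda>s'. ?\<rho> s') \<in> borel_measurable S"
    using k s by (rule density_section_measurable)
  have "(\<lambda>s'. \<integral>\<^sup>+\<omega>. ennreal (?X \<omega>) \<partial>path_law M \<pi> (Suc k) s') \<in> borel_measurable S"
      "(\<lambda>s'. \<integral>\<^sup>+\<omega>. ennreal (- ?X \<omega>) \<partial>path_law M \<pi> (Suc k) s') \<in> borel_measurable S"
    using X k by (auto intro!: measurable_compose[OF measurable_prob_algebraD[OF path_law_measurable]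
        nn_integral_measurable_subprob_algebra])
  then have pq [measurable]: "p \<in> borel_measurable ?R" "q \<in> borel_measurable ?R"
    unfolding p_def[abs_def] q_def[abs_def] using \<rho> by (auto intro!: measurable_safe)
  have C: "C s' = enn2ereal (p s') - enn2ereal (q s')" if "s' \<in> safe M" for s'
    using that safe_subset trans_density_nonneg[OF k s, of s']
    by (auto simp: C_def expected_cost_def xint_def p_def q_def diff_mult_ereal)
  have spaceR: "space ?R = safe M" by (simp add: space_restrict_space)
  show "C \<in> borel_measurable ?R"
    by (rule measurable_cong[THEN iffD2, OF C]) (auto simp: spaceR)
  have "(\<integral>\<^sup>+\<omega>. ennreal (- U \<omega>) \<partial>?P) \<le> (\<integral>\<^sup>+\<omega>. ennreal (- cost_until_exit M k \<pi> \<omega>) + ennreal ?l \<partial>?P)"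
    using start by (intro nn_integral_mono_AE) (auto elim!: eventually_mono intro!: ennreal_le_add_split)
  also have "\<dots> = (\<integral>\<^sup>+\<omega>. ennreal (- cost_until_exit M k \<pi> \<omega>) \<partial>?P) + ennreal ?l"
    using cost by (subst nn_integral_add) (auto simp: emeasure_space_1)
  also have "\<dots> < \<infinity>" using neg by simp
  finally have q: "(\<integral>\<^sup>+s'. q s' \<partial>?R) < \<infinity>" by (simp add: Uq)
  have "(\<integral>\<^sup>+s'. e2ennreal (- C s') \<partial>?R) \<le> (\<integral>\<^sup>+s'. q s' \<partial>?R)"
    by (intro nn_integral_mono) (auto simp: spaceR C intro: parts_of_difference)
  with q show "(\<integral>\<^sup>+s'. e2ennreal (- C s') \<partial>?R) < \<infinity>" by (rule le_less_trans[rotated])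
  show "(\<integral>\<^sup>+s'. e2ennreal (C s') \<partial>?R) < \<infinity>"
    if pos: "(\<integral>\<^sup>+\<omega>. ennreal (cost_until_exit M k \<pi> \<omega>) \<partial>?P) < \<infinity>"
  proof -
    have "(\<integral>\<^sup>+s'. e2ennreal (C s') \<partial>?R) \<le> (\<integral>\<^sup>+s'. p s' \<partial>?R)"
      by (intro nn_integral_mono) (auto simp: spaceR C intro: parts_of_difference)
    also have "\<dots> = (\<integral>\<^sup>+\<omega>. ennreal (U \<omega>) \<partial>?P)" by (simp add: Up)
    also have "\<dots> \<le> (\<integral>\<^sup>+\<omega>. ennreal (cost_until_exit M k \<pi> \<omega>) + ennreal (- ?l) \<partial>?P)"
      using start by (intro nn_integral_mono_AE) (auto elim!: eventually_mono intro!: ennreal_le_add_split)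
    also have "\<dots> = (\<integral>\<^sup>+\<omega>. ennreal (cost_until_exit M k \<pi> \<omega>) \<partial>?P) + ennreal (- ?l)"
      using cost by (subst nn_integral_add) (auto simp: emeasure_space_1)
    also have "\<dots> < \<infinity>" using pos by simp
    finally show ?thesis .
  qed
  have "expected_cost k s = xint ?P (\<lambda>\<omega>. ereal (?l + U \<omega>))"
    unfolding expected_cost_def using start by (intro xint_cong_AE) auto
  also have "\<dots> = ereal ?l + xint ?P (\<lambda>\<omega>. ereal (U \<omega>))"
    using U by (subst xint_add_integrable) (auto simp: prob_space)
  also have "xint ?P (\<lambda>\<omega>. ereal (U \<omega>)) = enn2ereal (\<integral>\<^sup>+s'. p s' \<partial>?R) - enn2ereal (\<integral>\<^sup>+s'. q s' \<partial>?R)"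
    by (simp add: xint_def Up Uq)
  also have "\<dots> = xint ?R (\<lambda>s'. enn2ereal (p s') - enn2ereal (q s'))"
    using q by (intro xint_diff_ennreal[symmetric]) auto
  also have "\<dots> = safe_xexpectation M s (\<pi> k s) (expected_cost (Suc k))"
    unfolding safe_xexpectation_def using C by (intro xint_cong) (simp add: spaceR C_def)
  finally show "expected_cost k s = ereal ?l + safe_xexpectation M s (\<pi> k s) (expected_cost (Suc k))" .
qed

lemma policy_value_duration:
  assumes "s \<in> states M"
  shows "policy_value \<zeta> (duration M) s = dp_value M \<zeta> (duration M) s"
proof -
  let ?n = "duration M" and ?\<omega> = "\<lambda>i\<in>{duration M}. s"
  have law: "path_law M \<pi> ?n s = return (paths ?n) ?\<omega>"
    by (simp add: path_law_def)
  have \<omega>: "?\<omega> \<in> space (paths ?n)" using assms by (auto simp: space_PiM)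
  have X: "cost_until_exit M ?n \<pi> \<in> borel_measurable (paths ?n)"
    by (rule cost_until_exit_measurable) simp
  have "cost_until_exit M ?n \<pi> ?\<omega> = terminal_cost M s"
    by (simp add: cost_until_exit_def)
  with X \<omega> have "expected_cost ?n s = ereal (terminal_cost M s)"
    unfolding expected_cost_def law xint_def
    by (subst (1 2) nn_integral_return) (auto simp: ereal_of_parts)
  then show ?thesis
    by (simp add: policy_value_def V_def dp_value_def)
qed

text \<open>The heart of the proof: by commutation, the penalty propagates like a terminal cost.\<close>

lemma policy_value_Suc:
  assumes \<zeta>: "\<zeta> \<in> borel_measurable (restrict_space borel {0..1})"
    and "commutes M \<zeta>" and "well_posed M \<zeta>"
    and k: "k < duration M" and s: "s \<in> safe M"
  shows "policy_value \<zeta> k s = dp_rhs M (policy_value \<zeta> (Suc k)) s (\<pi> k s)"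
proof -
  let ?R = "restrict_space lborel (safe M)" and ?\<rho> = "\<lambda>s'. ereal (trans_density M s' s (\<pi> k s))"
  let ?Z = "\<lambda>s'. \<zeta> (V M \<pi> (Suc k) s')"
  have st: "s \<in> states M" using s safe_subset by auto
  have wp: "(\<integral>\<^sup>+\<omega>. ennreal (- cost_until_exit M k \<pi> \<omega>) \<partial>path_law M \<pi> k s) < \<infinity>"
      "(\<integral>\<^sup>+\<omega>. ennreal (cost_until_exit M k \<pi> \<omega>) \<partial>path_law M \<pi> k s) < \<infinity> \<or>
       (\<integral>\<^sup>+s'. e2ennreal (- (?Z s' * ?\<rho> s')) \<partial>?R) < \<infinity>"
    using \<open>well_posed M \<zeta>\<close> policy k s
    by (auto simp: well_posed_def nn_integral_restrict_space)
  note step = expected_cost_Suc[OF k st wp(1)]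
  have "?Z \<in> borel_measurable S"
    using k by (intro measurable_compose[OF V_measurable \<zeta>]) simp
  moreover have "?\<rho> \<in> borel_measurable S"
    using density_section_measurable[OF k st] by simp
  ultimately have Z: "(\<lambda>s'. ?Z s' * ?\<rho> s') \<in> borel_measurable ?R"
    by (intro measurable_safe borel_measurable_ereal_times)
  have "safe_xexpectation M s (\<pi> k s) (policy_value \<zeta> (Suc k))
      = xint ?R (\<lambda>s'. expected_cost (Suc k) s' * ?\<rho> s' + ?Z s' * ?\<rho> s')"
    unfolding safe_xexpectation_def policy_value_def
    using trans_density_nonneg[OF k st] safe_subset
    by (intro xint_cong distrib_right_ereal_nonneg) (auto simp: space_restrict_space)
  also have "\<dots> = safe_xexpectation M s (\<pi> k s) (expected_cost (Suc k)) + safe_xexpectation M s (\<pi> k s) ?Z"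
    unfolding safe_xexpectation_def
    using step(2-4) Z wp(2) by (intro xint_add) auto
  also have "safe_xexpectation M s (\<pi> k s) ?Z = \<zeta> (V M \<pi> k s)"
    using \<open>commutes M \<zeta>\<close> policy k s by (simp add: commutes_def)
  finally show ?thesis
    by (simp add: policy_value_def[of \<zeta> k s] dp_rhs_def step(1) add.assoc)
qed

end

section \<open>Comparison with the dynamic programming recursion\<close>

lemma dp_value_Suc:
  assumes "k < duration M"
  shows "dp_value M \<zeta> k s = (INF a\<in>actions M. dp_rhs M (dp_value M \<zeta> (Suc k)) s a)"
proof -
  have "duration M - k = Suc (duration M - Suc k)"
    using assms by (rule Suc_diff_Suc[symmetric])
  then show ?thesis
    unfolding dp_value_def[abs_def] by (simp only: dp_steps.simps)
qed

lemma dp_rhs_mono: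
  assumes "valid_mission M" "s \<in> states M" "a \<in> actions M"
    and "\<And>s'. s' \<in> safe M \<Longrightarrow> J s' \<le> J' s'"
  shows "dp_rhs M J s a \<le> dp_rhs M J' s a"
  unfolding dp_rhs_def safe_xexpectation_def
  using assms by (intro add_left_mono xint_mono ereal_mult_right_mono)
    (auto simp: space_restrict_space valid_mission_def)

lemma dp_rhs_cong:
  assumes "\<And>s'. s' \<in> safe M \<Longrightarrow> J s' = J' s'"
  shows "dp_rhs M J s a = dp_rhs M J' s a"
  unfolding dp_rhs_def safe_xexpectation_def
  using assms by (intro arg_cong2[where f="(+)"] xint_cong) (auto simp: space_restrict_space)

lemma is_arg_min_INF:
  fixes f :: "'b \<Rightarrow> 'c::complete_linorder"
  assumes "is_arg_min f (\<lambda>x. x \<in> A) x"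
  shows "(INF x\<in>A. f x) = f x"
  using assms by (intro antisym INF_lower INF_greatest) (auto simp: is_arg_min_linorder)

text \<open>Along a policy that attains all the minima, the equation of \<open>policy_value_Suc\<close> is the dynamic
  programming recursion itself, and the terminal values agree by \<open>policy_value_duration\<close>.\<close>

lemma policy_value_minimizer:
  assumes "valid_mission M" "\<zeta> \<in> borel_measurable (restrict_space borel {0..1})"
    "commutes M \<zeta>" "well_posed M \<zeta>" and min: "dp_minimizer M \<zeta> \<pi>"
    and "k \<le> duration M" "s \<in> safe M"
  shows "controlled_mission.policy_value M \<pi> \<zeta> k s = dp_value M \<zeta> k s"
proof -
  interpret controlled_mission M \<pi>
    using assms(1) min by unfold_locales (auto simp: dp_minimizer_def)
  show ?thesis
    using \<open>k \<le> duration M\<close> \<open>s \<in> safe M\<close>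
  proof (induction k arbitrary: s rule: inc_induct)
    case base
    then show ?case using safe_subset by (auto intro: policy_value_duration)
  next
    case (step k)
    then have k: "k < duration M" by simp
    have "policy_value \<zeta> k s = dp_rhs M (policy_value \<zeta> (Suc k)) s (\<pi> k s)"
      using step.hyps step.prems by (intro policy_value_Suc assms(2-4)) auto
    also have "\<dots> = dp_rhs M (dp_value M \<zeta> (Suc k)) s (\<pi> k s)"
      by (intro dp_rhs_cong step.IH)
    also have "\<dots> = dp_value M \<zeta> k s"
    proof -
      have "is_arg_min (dp_rhs M (dp_value M \<zeta> (Suc k)) s) (\<lambda>a. a \<in> actions M) (\<pi> k s)"
        using min k step.prems by (simp add: dp_minimizer_def)
      from is_arg_min_INF[OF this] show ?thesis
        unfolding dp_value_Suc[OF k] by (rule sym)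
    qed
    finally show ?case .
  qed
qed

text \<open>In each step the action of the policy competes with the minimum, and monotonicity passes on the
  inequality that holds one step later.\<close>

lemma dp_value_le_policy_value:
  assumes "valid_mission M" "\<zeta> \<in> borel_measurable (restrict_space borel {0..1})"
    "commutes M \<zeta>" "well_posed M \<zeta>" "\<pi> \<in> policies M"
    and "k \<le> duration M" "s \<in> safe M"
  shows "dp_value M \<zeta> k s \<le> controlled_mission.policy_value M \<pi> \<zeta> k s"
proof -
  interpret controlled_mission M \<pi>
    using assms(1,5) by unfold_locales
  show ?thesis
    using \<open>k \<le> duration M\<close> \<open>s \<in> safe M\<close>
  proof (induction k arbitrary: s rule: inc_induct)
    case base
    then show ?case using safe_subset by (auto simp: policy_value_duration)
  next
    case (step k)
    then have s: "s \<in> states M" using safe_subset by auto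
    have a: "\<pi> k s \<in> actions M" using step.hyps s by (intro action_in) auto
    have "dp_value M \<zeta> k s \<le> dp_rhs M (dp_value M \<zeta> (Suc k)) s (\<pi> k s)"
      using step.hyps(2) a unfolding dp_value_Suc[OF step.hyps(2)] by (intro INF_lower)
    also have "\<dots> \<le> dp_rhs M (policy_value \<zeta> (Suc k)) s (\<pi> k s)"
      by (intro dp_rhs_mono assms(1) s a step.IH)
    also have "\<dots> = policy_value \<zeta> k s"
      using step.hyps step.prems by (intro policy_value_Suc[symmetric] assms(2-4)) auto
    finally show ?case .
  qed
qed

text \<open>The cost after exit may be removed from the extended integral because it is integrable, even if
  the cost until exit has infinite mean.\<close>

lemma objective_mission_cost:
  assumes "valid_mission M" "\<pi> \<in> policies M" "s \<in> safe M" "no_cost_after_exit M s"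
  shows "objective M \<zeta> (mission_cost M) s \<pi> = objective M \<zeta> (cost_until_exit M 0) s \<pi>"
proof -
  interpret controlled_mission M \<pi> using assms(1,2) by unfold_locales
  let ?P = "path_law M \<pi> 0 s"
  let ?D = "\<lambda>\<omega>. mission_cost M \<pi> \<omega> - cost_until_exit M 0 \<pi> \<omega>"
  have D: "integrable ?P ?D" "(\<integral>\<omega>. ?D \<omega> \<partial>?P) = 0"
    using assms(2,4) by (auto simp: no_cost_after_exit_def)
  have "cost_until_exit M 0 \<pi> \<in> borel_measurable ?P"
    using assms(3) safe_subset by (auto simp: measurable_path_law cost_until_exit_measurable)
  from xint_add_integrable[OF D(1) this] D(2) show ?thesis
    by (simp add: objective_def zero_ereal_def[symmetric])
qed

theorem proposition1:
  fixes M :: "(real ^ 'ns, real ^ 'na) mission"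
    and \<zeta> :: "real \<Rightarrow> ereal"
  assumes "valid_mission M"
    and "\<zeta> \<in> borel_measurable (restrict_space borel {0..1})"
    and "commutes M \<zeta>"
    and "well_posed M \<zeta>"
    and min_attained: "\<exists>\<pi>. dp_minimizer M \<zeta> \<pi>"
  shows "\<forall>s\<^sub>0\<in>safe M.
      (no_cost_after_exit M s\<^sub>0 \<longrightarrow>
         optimal_cost M \<zeta> (mission_cost M) s\<^sub>0 = dp_value M \<zeta> 0 s\<^sub>0 \<and>
         (\<forall>\<pi>. dp_minimizer M \<zeta> \<pi> \<longrightarrow> optimal_policy M \<zeta> (mission_cost M) s\<^sub>0 \<pi>)) \<and>
      optimal_cost M \<zeta> (cost_until_exit M 0) s\<^sub>0 = dp_value M \<zeta> 0 s\<^sub>0 \<and>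
      (\<forall>\<pi>. dp_minimizer M \<zeta> \<pi> \<longrightarrow> optimal_policy M \<zeta> (cost_until_exit M 0) s\<^sub>0 \<pi>)"
proof
  fix s assume s: "s \<in> safe M"
  let ?W = "\<lambda>\<pi>. controlled_mission.policy_value M \<pi> \<zeta> 0 s"
  have exit: "objective M \<zeta> (cost_until_exit M 0) s \<pi> = ?W \<pi>" if "\<pi> \<in> policies M" for \<pi>
  proof -
    interpret controlled_mission M \<pi> using assms(1) that by unfold_locales
    show ?thesis by (simp add: objective_def policy_value_def expected_cost_def)
  qed
  \<comment> \<open>Which cost is used matters only through the objective, so both cases are treated at once.\<close>
  have minimal: "optimal_cost M \<zeta> cost s = dp_value M \<zeta> 0 s \<and>
      (\<forall>\<pi>. dp_minimizer M \<zeta> \<pi> \<longrightarrow> optimal_policy M \<zeta> cost s \<pi>)"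
    if obj: "\<And>\<pi>. \<pi> \<in> policies M \<Longrightarrow> objective M \<zeta> cost s \<pi> = ?W \<pi>" for cost
  proof -
    have le: "dp_value M \<zeta> 0 s \<le> objective M \<zeta> cost s \<pi>" if "\<pi> \<in> policies M" for \<pi>
      using dp_value_le_policy_value[OF assms(1-4) that _ s, of 0] obj[OF that] by simp
    have eq: "objective M \<zeta> cost s \<pi> = dp_value M \<zeta> 0 s" if "dp_minimizer M \<zeta> \<pi>" for \<pi>
      using policy_value_minimizer[OF assms(1-4) that _ s, of 0] obj[of \<pi>] that
      by (simp add: dp_minimizer_def)
    have opt: "optimal_policy M \<zeta> cost s \<pi>" if "dp_minimizer M \<zeta> \<pi>" for \<pi>
      using le eq[OF that] that
      by (auto simp: optimal_policy_def is_arg_min_linorder dp_minimizer_def)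
    obtain \<pi> where "dp_minimizer M \<zeta> \<pi>" using min_attained by blast
    then have "optimal_cost M \<zeta> cost s = dp_value M \<zeta> 0 s"
      using is_arg_min_INF[OF opt[unfolded optimal_policy_def]] eq by (simp add: optimal_cost_def)
    with opt show ?thesis by blast
  qed
  have "objective M \<zeta> (mission_cost M) s \<pi> = ?W \<pi>" if "no_cost_after_exit M s" "\<pi> \<in> policies M" for \<pi>
    using objective_mission_cost[OF assms(1) that(2) s that(1)] exit[OF that(2)] by simp
  with minimal[of "mission_cost M"] minimal[of "cost_until_exit M 0"] exit
  show "(no_cost_after_exit M s \<longrightarrow>
         optimal_cost M \<zeta> (mission_cost M) s = dp_value M \<zeta> 0 s \<and>
         (\<forall>\<pi>. dp_minimizer M \<zeta> \<pi> \<longrightarrow> optimal_policy M \<zeta> (mission_cost M) s \<pi>)) \<and>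
      optimal_cost M \<zeta> (cost_until_exit M 0) s = dp_value M \<zeta> 0 s \<and>
      (\<forall>\<pi>. dp_minimizer M \<zeta> \<pi> \<longrightarrow> optimal_policy M \<zeta> (cost_until_exit M 0) s \<pi>)"
    by blast
qed

end
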